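(* Let $G=(V,E,l)$ be a finite connected undirected simple metric graph with at least one edge, let $v^*\in V$, and let $(G,l,\{\sigma_v\}_{v\in V},\pi_0)$ be ordered graph data with associated auxiliary interval exchange transformation $T_{\mathrm{aux}}$. Assume that $T_{\mathrm{aux}}$ satisfies the $\varepsilon$-birth-time transfer estimate with function $H_T(\varepsilon)$. Then, for all sufficiently small $\varepsilon>0$, $$\tau_s(\varepsilon)\le H_T(\varepsilon)+\max_{e\in E}l(e),$$ where $\tau_s(\varepsilon)$ is the moment of permanent $\varepsilon$-saturation of $\mathcal W(G,v^* )$.
   Context: A metric graph $G=(V,E,l)$ is a graph $(V,E)$ with a length function $l:E\to\mathbb R_{>0}$; each edge $e$ is identified with an interval of length $l(e)$. Graphs are undirected and simple (no loops, at most one edge between two vertices). $\overrightarrow E$ is the set of oriented edges. For $a=(u\to w)\in\overrightarrow E$ put $\bar a=(w\to u)$, $t(a)=u$, $h(a)=w$, $l(a)=l(\{u,w\})$. A walk from $v^*$ to $v$ is a finite sequence of vertices $(v_0,\dots,v_n)$ with $v_0=v^*$, $v_n=v$, $\{v_{i-1},v_i\}\in E$; its metric length is $\sum_i l(\{v_{i-1},v_i\})$ (the empty walk at $v^*$ has length $0$). $\mathcal A_v$ is the set of metric lengths of all finite walks from $v^*$ to $v$; its elements are the birth times at $v$. The dynamics $\mathcal W(G,v^* )$ (time $t\in\mathbb R_{\ge 0}$, space the metric graph): each moving point lies on an oriented edge and moves at unit speed toward its head. When a moving point reaches a vertex $v$, it is removed and new moving points are created at $v$, one on each oriented edge issuing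 from $v$ (including the reverse of the edge of arrival), each moving away from $v$ at unit speed. At time $0$ moving points are created at $v^*$ on all oriented edges issuing from $v^*$. The system is $\varepsilon$-saturated at time $t$ if the moving points at time $t$ form an $\varepsilon$-net of the metric graph (every point is within distance at most $\varepsilon$ of some moving point). $\tau_s(\varepsilon)=\inf\{t_0\ge0:\mathcal W(G,v^* )\text{ is }\varepsilon\text{-saturated at every }t\ge t_0\}$ (with $\inf\emptyset=+\infty$). Ordered graph data: for each $v\in V$, $\sigma_v$ is a cyclic permutation (a single cycle) of $\{a\in\overrightarrow E:t(a)=v\}$, and $\pi_0:\overrightarrow E\to\{1,\dots,d\}$, $d=|\overrightarrow E|$, is a bijection. Put $\Phi(a)=\sigma_{h(a)}(\bar a)$ (a permutation of $\overrightarrow E$), define $\pi_1$ by $\pi_1(\Phi(a))=\pi_0(a)$, let $\lambda_a=l(a)$ and $L=\sum_a\lambda_a$. The auxiliary IET $T_{\mathrm{aux}}:[0,L)\to[0,L)$ translates, for each $a$, the interval $I_a=[\sum_{\pi_0(b)<\pi_0(a)}\lambda_b,\sum_{\pi_0(b)\le\pi_0(a)}\lambda_b)$ onto $J_a=[\sum_{\pi_1(b)<\pi_1(a)}\lambda_b,\sum_{\pi_1(b)\le\pi_1(a)}\lambda_b)$. Transfer estimate: $T_{\mathrm{aux}}$ satisfies an $\varepsilon$-birth-time transfer estimate with function $H_T(\varepsilon)$ if, for every sufficiently small $\varepsilon>0$, every oriented edge $a=(u\to w)$, every $t\ge H_T(\varepsilon)+l(a)$, and every $s\in[0,l(a)-\varepsilon]$,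 there exists a birth time $\tau\in\mathcal A_u$ such that $0\le t-s-\tau\le\varepsilon$. *)

theory Defs
  imports Complex_Main "HOL-Library.Extended_Real" "HOL-Library.FuncSet" "HOL-Combinatorics.Orbits"
begin

section \<open>Metric graphs\<close>

definition metric_graph :: "'v set \<Rightarrow> 'v set set \<Rightarrow> ('v set \<Rightarrow> real) \<Rightarrow> bool" where
  "metric_graph V E l \<longleftrightarrow>
     (\<forall>e\<in>E. e \<subseteq> V \<and> card e = 2) \<and> (\<forall>e\<in>E. 0 < l e)"

definition walk :: "'v set \<Rightarrow> 'v set set \<Rightarrow> 'v \<Rightarrow> 'v list \<Rightarrow> 'v \<Rightarrow> bool" where
  "walk V E u p v \<longleftrightarrow>
     p \<noteq> [] \<and> hd p = u \<and> last p = v \<and> set p \<subseteq> V \<and> successively (\<lambda>x y. {x, y} \<in> E) p"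

definition walk_length :: "('v set \<Rightarrow> real) \<Rightarrow> 'v list \<Rightarrow> real" where
  "walk_length l p = (\<Sum>i<length p - 1. l {p ! i, p ! Suc i})"

definition connected_graph :: "'v set \<Rightarrow> 'v set set \<Rightarrow> bool" where
  "connected_graph V E \<longleftrightarrow> V \<noteq> {} \<and> (\<forall>u\<in>V. \<forall>v\<in>V. \<exists>p. walk V E u p v)"

definition birth_times :: "'v set \<Rightarrow> 'v set set \<Rightarrow> ('v set \<Rightarrow> real) \<Rightarrow> 'v \<Rightarrow> 'v \<Rightarrow> real set" where
  "birth_times V E l vs v = {walk_length l p | p. walk V E vs p v}"

text \<open>An oriented edge \<open>u \<rightarrow> w\<close> is the pair \<open>(u, w)\<close>.\<close>

type_synonym 'v arc = "'v \<times> 'v"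

abbreviation tail :: "'v arc \<Rightarrow> 'v" where "tail \<equiv> fst"
abbreviation head :: "'v arc \<Rightarrow> 'v" where "head \<equiv> snd"
abbreviation rev_arc :: "'v arc \<Rightarrow> 'v arc" where "rev_arc \<equiv> prod.swap"

definition arcs :: "'v set set \<Rightarrow> 'v arc set" where
  "arcs E = {(u, w). {u, w} \<in> E}"

definition out_arcs :: "'v set set \<Rightarrow> 'v \<Rightarrow> 'v arc set" where
  "out_arcs E v = {a \<in> arcs E. tail a = v}"

definition arc_length :: "('v set \<Rightarrow> real) \<Rightarrow> 'v arc \<Rightarrow> real" where
  "arc_length l a = l {tail a, head a}"

text \<open>
  The pair \<open>(a, x)\<close> is a coordinate of the point of the edge underlying \<open>a\<close> that
  lies at distance \<open>x\<close> from the tail of \<open>a\<close>. A point has several coordinates: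
  \<open>(a, x)\<close> and \<open>(rev_arc a, arc_length l a - x)\<close> are the same point, and
  so are \<open>(a, 0)\<close> and \<open>(b, 0)\<close> when \<open>a\<close> and \<open>b\<close> have the same tail. The
  metric graph is the quotient by these identifications.
\<close>

type_synonym 'v coord = "'v arc \<times> real"

definition points :: "'v set set \<Rightarrow> ('v set \<Rightarrow> real) \<Rightarrow> 'v coord set" where
  "points E l = {(a, x). a \<in> arcs E \<and> 0 \<le> x \<and> x \<le> arc_length l a}"

text \<open>
  \<open>path_of_length E l p q r\<close>: the points \<open>p\<close> and \<open>q\<close> are joined by a
  concatenation of finitely many segments, each inside one edge, of total length
  \<open>r\<close>. The rules \<open>flip\<close> and \<open>vertex\<close> change the coordinate, not the point.
\<close>

inductive path_of_length ::
  "'v set set \<Rightarrow> ('v set \<Rightarrow> real) \<Rightarrow> 'v coord \<Rightarrow> 'v coord \<Rightarrow> real \<Rightarrow> bool"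
  for E :: "'v set set" and l :: "'v set \<Rightarrow> real" and p :: "'v coord" where
  start: "p \<in> points E l \<Longrightarrow> path_of_length E l p p 0"
| segment: "path_of_length E l p (a, x) r \<Longrightarrow> 0 \<le> y \<Longrightarrow> y \<le> arc_length l a \<Longrightarrow>
     path_of_length E l p (a, y) (r + \<bar>x - y\<bar>)"
| flip: "path_of_length E l p (a, x) r \<Longrightarrow>
     path_of_length E l p (rev_arc a, arc_length l a - x) r"
| vertex: "path_of_length E l p (a, 0) r \<Longrightarrow> b \<in> arcs E \<Longrightarrow> tail b = tail a \<Longrightarrow>
     path_of_length E l p (b, 0) r"

text \<open>
  The path metric. The infimum is over a nonempty set, and so meaningful, when the
  graph is connected.
\<close>

definition graph_dist :: "'v set set \<Rightarrow> ('v set \<Rightarrow> real) \<Rightarrow> 'v coord \<Rightarrow> 'v coord \<Rightarrow> real" where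
  "graph_dist E l p q = Inf {r. path_of_length E l p q r}"

section \<open>The dynamics\<close>

text \<open>
  \<open>created E l vs a t\<close>: a moving point is created at time \<open>t\<close> at the tail of \<open>a\<close>
  and starts along \<open>a\<close>. It arrives at the head of \<open>a\<close> at time
  \<open>t + arc_length l a\<close>.
\<close>

inductive created :: "'v set set \<Rightarrow> ('v set \<Rightarrow> real) \<Rightarrow> 'v \<Rightarrow> 'v arc \<Rightarrow> real \<Rightarrow> bool"
  for E :: "'v set set" and l :: "'v set \<Rightarrow> real" and vs :: 'v where
  initial: "a \<in> out_arcs E vs \<Longrightarrow> created E l vs a 0"
| arrival: "created E l vs a t \<Longrightarrow> b \<in> out_arcs E (head a) \<Longrightarrow>
     created E l vs b (t + arc_length l a)"

text \<open>
  A moving point is removed on reaching the head of its oriented edge, hence the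
  strict inequality \<open>x < arc_length l a\<close>.
\<close>

definition moving_points ::
  "'v set set \<Rightarrow> ('v set \<Rightarrow> real) \<Rightarrow> 'v \<Rightarrow> real \<Rightarrow> 'v coord set" where
  "moving_points E l vs t =
     {(a, x). 0 \<le> x \<and> x < arc_length l a \<and> created E l vs a (t - x)}"

definition saturated ::
  "'v set set \<Rightarrow> ('v set \<Rightarrow> real) \<Rightarrow> 'v \<Rightarrow> real \<Rightarrow> real \<Rightarrow> bool" where
  "saturated E l vs \<epsilon> t \<longleftrightarrow>
     (\<forall>p\<in>points E l. \<exists>m\<in>moving_points E l vs t. graph_dist E l p m \<le> \<epsilon>)"

definition saturation_time ::
  "'v set set \<Rightarrow> ('v set \<Rightarrow> real) \<Rightarrow> 'v \<Rightarrow> real \<Rightarrow> ereal" where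
  "saturation_time E l vs \<epsilon> =
     Inf (ereal ` {t0. 0 \<le> t0 \<and> (\<forall>t\<ge>t0. saturated E l vs \<epsilon> t)})"

section \<open>Ordered graph data and the auxiliary interval exchange\<close>

definition ordered_graph_data ::
  "'v set \<Rightarrow> 'v set set \<Rightarrow> ('v \<Rightarrow> 'v arc \<Rightarrow> 'v arc) \<Rightarrow> ('v arc \<Rightarrow> nat) \<Rightarrow> bool" where
  "ordered_graph_data V E \<sigma> \<pi>0 \<longleftrightarrow>
     (\<forall>v\<in>V. bij_betw (\<sigma> v) (out_arcs E v) (out_arcs E v) \<and> cyclic_on (\<sigma> v) (out_arcs E v)) \<and>
     bij_betw \<pi>0 (arcs E) {1..card (arcs E)}"

definition next_arc :: "('v \<Rightarrow> 'v arc \<Rightarrow> 'v arc) \<Rightarrow> 'v arc \<Rightarrow> 'v arc" where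
  "next_arc \<sigma> a = \<sigma> (head a) (rev_arc a)"

definition image_order ::
  "'v set set \<Rightarrow> ('v \<Rightarrow> 'v arc \<Rightarrow> 'v arc) \<Rightarrow> ('v arc \<Rightarrow> nat) \<Rightarrow> 'v arc \<Rightarrow> nat" where
  "image_order E \<sigma> \<pi>0 a = \<pi>0 (inv_into (arcs E) (next_arc \<sigma>) a)"

definition left_end ::
  "'v set set \<Rightarrow> ('v set \<Rightarrow> real) \<Rightarrow> ('v arc \<Rightarrow> nat) \<Rightarrow> 'v arc \<Rightarrow> real" where
  "left_end E l \<pi> a = (\<Sum>b | b \<in> arcs E \<and> \<pi> b < \<pi> a. arc_length l b)"

definition arc_interval ::
  "'v set set \<Rightarrow> ('v set \<Rightarrow> real) \<Rightarrow> ('v arc \<Rightarrow> nat) \<Rightarrow> 'v arc \<Rightarrow> real set" where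
  "arc_interval E l \<pi> a =
     {left_end E l \<pi> a ..< (\<Sum>b | b \<in> arcs E \<and> \<pi> b \<le> \<pi> a. arc_length l b)}"

definition total_length :: "'v set set \<Rightarrow> ('v set \<Rightarrow> real) \<Rightarrow> real" where
  "total_length E l = (\<Sum>a\<in>arcs E. arc_length l a)"

definition aux_iet ::
  "'v set set \<Rightarrow> ('v set \<Rightarrow> real) \<Rightarrow> ('v \<Rightarrow> 'v arc \<Rightarrow> 'v arc) \<Rightarrow> ('v arc \<Rightarrow> nat) \<Rightarrow>
     real \<Rightarrow> real" where
  "aux_iet E l \<sigma> \<pi>0 =
     (\<lambda>x\<in>{0..<total_length E l}.
        let a = (THE a. a \<in> arcs E \<and> x \<in> arc_interval E l \<pi>0 a)
        in x - left_end E l \<pi>0 a + left_end E l (image_order E \<sigma> \<pi>0) a)"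

text \<open>
  The transfer estimate is a property attributed to the interval exchange \<open>T\<close>, but
  the condition itself is phrased through the birth times alone; therefore \<open>T\<close> does
  not occur on the right-hand side.
\<close>

definition transfer_estimate ::
  "'v set \<Rightarrow> 'v set set \<Rightarrow> ('v set \<Rightarrow> real) \<Rightarrow> 'v \<Rightarrow> (real \<Rightarrow> real) \<Rightarrow> (real \<Rightarrow> real) \<Rightarrow> bool" where
  "transfer_estimate V E l vs T H \<longleftrightarrow>
     (\<forall>\<^sub>F \<epsilon> in at_right 0. \<forall>a\<in>arcs E. \<forall>t \<ge> H \<epsilon> + arc_length l a. \<forall>s\<in>{0..arc_length l a - \<epsilon>}.
        \<exists>\<tau>\<in>birth_times V E l vs (tail a). 0 \<le> t - s - \<tau> \<and> t - s - \<tau> \<le> \<epsilon>)"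

end

theory Submission
  imports Defs
begin

text \<open>
  A birth time \<open>\<tau>\<close> at the tail of \<open>a\<close> puts a moving point at position \<open>t - \<tau>\<close> of \<open>a\<close> at time
  \<open>t\<close>, as long as \<open>t - \<tau> \<le> arc_length l a\<close>. To approximate the point at position \<open>x\<close>, apply the
  transfer estimate with \<open>s = min x (arc_length l a - \<epsilon>)\<close>: the position \<open>t - \<tau>\<close> then lies in
  \<open>[s, s + \<epsilon>]\<close>, which contains \<open>x\<close> and stays on the arc.
\<close>

lemma walk_length_snoc:
  assumes "p \<noteq> []"
  shows "walk_length l (p @ [v]) = walk_length l p + l {last p, v}"
proof -
  obtain n where n: "length p = Suc n"
    using assms by (cases p) auto
  have "(\<Sum>i<n. l {(p @ [v]) ! i, (p @ [v]) ! Suc i}) = (\<Sum>i<n. l {p ! i, p ! Suc i})"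
    by (rule sum.cong) (auto simp: nth_append n)
  then show ?thesis
    using assms n by (simp add: walk_length_def nth_append last_conv_nth)
qed

lemma walk_length_nonneg:
  assumes "metric_graph V E l" and "walk V E u p v"
  shows "0 \<le> walk_length l p"
  unfolding walk_length_def
proof (rule sum_nonneg)
  fix i assume "i \<in> {..<length p - 1}"
  then have "{p ! i, p ! Suc i} \<in> E"
    using assms(2) by (auto simp: walk_def successively_conv_nth)
  then show "0 \<le> l {p ! i, p ! Suc i}"
    using assms(1) by (auto simp: metric_graph_def less_imp_le)
qed

text \<open>Induction from the end of the walk: a one-vertex walk is the creation at time 0, and a
  further vertex \<open>w\<close> is one arrival along \<open>(last p, w)\<close>. The arc stays
  arbitrary because the induction hypothesis is used for \<open>(last p, w)\<close>, not for
  \<open>a\<close>.\<close>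

lemma created_walk_length:
  assumes "walk V E vs p v" and "a \<in> out_arcs E v"
  shows "created E l vs a (walk_length l p)"
  using assms
proof (induction p arbitrary: v a rule: rev_induct)
  case Nil
  then show ?case by (simp add: walk_def)
next
  case (snoc w p)
  show ?case
  proof (cases "p = []")
    case True
    then show ?thesis
      using snoc.prems by (auto simp: walk_def walk_length_def intro: created.initial)
  next
    case False
    have walk: "walk V E vs p (last p)" and edge: "{last p, w} \<in> E" and "w = v"
      using snoc.prems(1) False by (auto simp: walk_def successively_append_iff)
    have "created E l vs (last p, w) (walk_length l p)"
      using snoc.IH[OF walk] edge by (simp add: out_arcs_def arcs_def)
    then have "created E l vs a (walk_length l p + arc_length l (last p, w))"
      by (rule created.arrival) (use snoc.prems(2) \<open>w = v\<close> in simp)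
    then show ?thesis
      by (simp add: walk_length_snoc[OF False] arc_length_def)
  qed
qed

lemma created_birth_time:
  assumes "\<tau> \<in> birth_times V E l vs (tail a)" and "a \<in> arcs E"
  shows "created E l vs a \<tau>"
proof -
  from assms(1) obtain p where "\<tau> = walk_length l p" "walk V E vs p (tail a)"
    by (auto simp: birth_times_def)
  then show ?thesis
    using created_walk_length[of V E vs p "tail a" a l] assms(2) by (simp add: out_arcs_def)
qed

lemma path_of_length_nonneg: "path_of_length E l p q r \<Longrightarrow> 0 \<le> r"
  by (induction rule: path_of_length.induct) auto

text \<open>Nonnegative path lengths bound the set below, so its infimum is at most each
  member.\<close>

lemma graph_dist_le: "path_of_length E l p q r \<Longrightarrow> graph_dist E l p q \<le> r"
  unfolding graph_dist_def
  by (intro cInf_lower bdd_belowI[of _ 0]) (auto intro: path_of_length_nonneg)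

text \<open>Both points lie on \<open>a\<close>, so the segment between them bounds the distance.
  The position \<open>t - \<tau>\<close> may equal the arc length, since the window given by the
  transfer estimate can reach the head.\<close>

lemma created_near_moving_point:
  assumes a: "a \<in> arcs E" "0 < arc_length l a" and created: "created E l vs a \<tau>"
    and pos: "0 \<le> t - \<tau>" "t - \<tau> \<le> arc_length l a" and x: "(a, x) \<in> points E l"
  shows "\<exists>m\<in>moving_points E l vs t. graph_dist E l (a, x) m \<le> \<bar>x - (t - \<tau>)\<bar>"
proof -
  \<comment> \<open>The summand \<open>0\<close> is the length of the trivial path from
    \<open>start\<close>, kept so that \<open>segment\<close> applies as stated.\<close>
  have path: "path_of_length E l (a, x) (a, t - \<tau>) (0 + \<bar>x - (t - \<tau>)\<bar>)"
    by (intro path_of_length.segment path_of_length.start x pos)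
  show ?thesis
  proof (cases "t - \<tau> < arc_length l a")
    case True
    then have "(a, t - \<tau>) \<in> moving_points E l vs t"
      using pos created by (simp add: moving_points_def)
    then show ?thesis
      using graph_dist_le[OF path] by auto
  next
    \<comment> \<open>The point is removed at the head exactly at time \<open>t\<close>; the one created there on the
      reversed arc is at the same place.\<close>
    case False
    then have end_pos: "t - \<tau> = arc_length l a"
      using pos by simp
    have rev: "arc_length l (rev_arc a) = arc_length l a"
      by (cases a) (simp add: arc_length_def insert_commute)
    have "rev_arc a \<in> out_arcs E (head a)"
      using a(1) by (cases a) (simp add: out_arcs_def arcs_def insert_commute)
    then have "created E l vs (rev_arc a) t"
      using created.arrival[OF created] end_pos by (metis add.commute diff_add_cancel)
    then have "(rev_arc a, 0) \<in> moving_points E l vs t"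
      using a(2) rev by (simp add: moving_points_def)
    \<comment> \<open>\<open>flip\<close> turns position \<open>arc_length l a\<close> on
      \<open>a\<close> into position 0 on the reversed arc at no cost.\<close>
    moreover have "path_of_length E l (a, x) (rev_arc a, 0) \<bar>x - (t - \<tau>)\<bar>"
      using path_of_length.flip[OF path] end_pos by simp
    ultimately show ?thesis
      using graph_dist_le by blast
  qed
qed

theorem proposition3p15:
  fixes V :: "'v set" and E :: "'v set set" and l :: "'v set \<Rightarrow> real" and vs :: 'v
    and \<sigma> :: "'v \<Rightarrow> 'v \<times> 'v \<Rightarrow> 'v \<times> 'v" and \<pi>0 :: "'v \<times> 'v \<Rightarrow> nat"
    and H :: "real \<Rightarrow> real"
  assumes "metric_graph V E l" and "finite V" and "connected_graph V E" and "E \<noteq> {}"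
    and "vs \<in> V"
    and "ordered_graph_data V E \<sigma> \<pi>0"
    and "transfer_estimate V E l vs (aux_iet E l \<sigma> \<pi>0) H"
  shows "\<forall>\<^sub>F \<epsilon> in at_right 0. saturation_time E l vs \<epsilon> \<le> ereal (H \<epsilon> + Max (l ` E))"
proof -
  have "E \<subseteq> Pow V"
    using assms(1) by (auto simp: metric_graph_def)
  then have fin: "finite E"
    using assms(2) by (meson finite_Pow_iff finite_subset)
  have edge: "{tail a, head a} \<in> E" if "a \<in> arcs E" for a
    using that by (auto simp: arcs_def)
  have pos: "0 < l e" if "e \<in> E" for e
    using assms(1) that by (simp add: metric_graph_def)
  \<comment> \<open>Fixes one arc, on which \<open>H \<epsilon>\<close> is bounded from below at the
    end.\<close>
  obtain e where e: "e \<in> E"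
    using assms(4) by blast
  then have "card e = 2"
    using assms(1) by (simp add: metric_graph_def)
  then obtain u w where "e = {u, w}"
    by (auto simp: card_2_iff)
  then have arc: "(u, w) \<in> arcs E"
    using e by (simp add: arcs_def)
  have le_Max: "arc_length l a \<le> Max (l ` E)" if "a \<in> arcs E" for a
    using edge[OF that] fin by (simp add: arc_length_def)
  \<comment> \<open>Finitely many edges give a common threshold; below it every range
    \<open>{0..arc_length l a - \<epsilon>}\<close> is nonempty.\<close>
  have "\<forall>\<^sub>F \<epsilon> in at_right 0. \<forall>e\<in>E. \<epsilon> < l e"
    using fin pos by (auto intro!: eventually_ball_finite order_tendstoD(2)[of _ 0] tendsto_ident_at)
  moreover have "\<forall>\<^sub>F \<epsilon> in at_right (0::real). 0 < \<epsilon>"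
    by (rule eventually_at_right_less)
  ultimately show ?thesis
    using assms(7)[unfolded transfer_estimate_def]
  proof eventually_elim
    case (elim \<epsilon>)
    have short: "\<epsilon> < arc_length l a" if "a \<in> arcs E" for a
      using elim(1) edge[OF that] by (simp add: arc_length_def)
    have sat: "saturated E l vs \<epsilon> t" if t: "H \<epsilon> + Max (l ` E) \<le> t" for t
      unfolding saturated_def
    proof
      fix p assume p: "p \<in> points E l"
      then obtain a x where "p = (a, x)" and a: "a \<in> arcs E"
        and x: "0 \<le> x" "x \<le> arc_length l a"
        by (auto simp: points_def)
      define s where "s = min x (arc_length l a - \<epsilon>)"
      have "H \<epsilon> + arc_length l a \<le> t" "s \<in> {0..arc_length l a - \<epsilon>}"
        using t le_Max[OF a] short[OF a] x by (auto simp: s_def)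
      then obtain \<tau> where \<tau>: "\<tau> \<in> birth_times V E l vs (tail a)"
        and close: "0 \<le> t - s - \<tau>" "t - s - \<tau> \<le> \<epsilon>"
        using elim(3) a by blast
      have "0 \<le> t - \<tau>" "t - \<tau> \<le> arc_length l a" and dist: "\<bar>x - (t - \<tau>)\<bar> \<le> \<epsilon>"
        using close x short[OF a] unfolding s_def by linarith+
      then obtain m where "m \<in> moving_points E l vs t"
        "graph_dist E l (a, x) m \<le> \<bar>x - (t - \<tau>)\<bar>"
        using created_near_moving_point[OF a _ created_birth_time[OF \<tau> a]] p \<open>p = (a, x)\<close>
          short[OF a] elim(2) by fastforce
      then show "\<exists>m\<in>moving_points E l vs t. graph_dist E l p m \<le> \<epsilon>"
        using dist \<open>p = (a, x)\<close> order_trans by blast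
    qed
    \<comment> \<open>Birth times are nonnegative, so the estimate at the end of an arc forces
      \<open>H \<epsilon> \<ge> - \<epsilon>\<close>.\<close>
    have "\<exists>\<tau>\<in>birth_times V E l vs u.
        0 \<le> (H \<epsilon> + arc_length l (u, w)) - (arc_length l (u, w) - \<epsilon>) - \<tau>"
      using elim(3) arc short[OF arc] by fastforce
    then have "0 \<le> H \<epsilon> + \<epsilon>"
      using walk_length_nonneg[OF assms(1)] by (fastforce simp: birth_times_def)
    \<comment> \<open>\<open>saturation_time\<close> is an infimum over nonnegative times, so the
      bound must be nonnegative to belong to that set. The deficit \<open>\<epsilon>\<close> is
      absorbed by the length of \<open>(u, w)\<close>.\<close>
    then have "0 \<le> H \<epsilon> + Max (l ` E)"
      using short[OF arc] le_Max[OF arc] by linarith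
    then show ?case
      unfolding saturation_time_def using sat by (intro Inf_lower imageI) simp
  qed
qed

end
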